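(* For every integer $i\ge 3$, there exists a tree $T$ with a bipartition $(V_r,V_w)$ of $V(T)$ into two independent sets such that $mh_{V_r}(T)\ge i$ and $h_{V_r}(T)=h(T)=2$.
   Context: Hunters and Rabbit game on a graph $G=(V,E)$. A hunter strategy is a finite sequence $(S_1,\dots,S_\ell)$ of non-empty subsets of $V$, using $\max_i|S_i|$ hunters. A rabbit trajectory starting from $W\subseteq V$ is a walk $(r_0,\dots,r_\ell)$ with $r_0\in W$ and $r_i\in N(r_{i-1})$. A strategy is winning with respect to $W$ if every rabbit trajectory starting from $W$ has some $j<\ell$ with $r_j\in S_{j+1}$. $h_W(G)$ is the minimum number of hunters of a winning strategy with respect to $W$, and $h(G)=h_V(G)$. Contaminated sets with respect to $W$: $Z_0=W$, $Z_i=\{x : \exists y\in Z_{i-1}\setminus S_i,\ xy\in E\}$. A vertex $v$ is cleared at round $i$ if $v\in S_i$, or $N(v)\cap Z_{i-1}\ne\emptyset$ and $N(v)\cap Z_{i-1}\subseteq S_i$. A strategy is monotone if any vertex $v$ cleared at some round $i$ satisfies $v\in S_{j+1}$ whenever $j>i$ and $v\in Z_j$. $mh_W(G)$ is the minimum number of hunters of a monotone winning hunter strategy with respect to $W$. *)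

theory Defs
  imports "Graph_Theory.Digraph_Component" "Graph_Theory.Pair_Digraph"
begin

(* A finite simple graph is a pair_graph: a finite vertex set pverts with a symmetric
   irreflexive relation parcs, so an edge uv is the pair of arcs (u,v) and (v,u). *)

(* Digraph_Component.tree forbids all directed cycles, hence also u -> v -> u, so it is false
   for every symmetric digraph with an edge.  The cycles of the undirected graph are the
   directed cycles of length at least 3. *)
definition undirected_tree :: "'a pair_pre_digraph \<Rightarrow> bool" where
  "undirected_tree G \<longleftrightarrow> pair_graph G \<and> Digraph_Component.connected (with_proj G) \<and>
     \<not> (\<exists>p. pre_digraph.cycle (with_proj G) p \<and> 3 \<le> length p)"

definition nbrs :: "'a pair_pre_digraph \<Rightarrow> 'a \<Rightarrow> 'a set" where
  "nbrs G v = {w. (v, w) \<in> parcs G}"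

definition independent_set :: "'a pair_pre_digraph \<Rightarrow> 'a set \<Rightarrow> bool" where
  "independent_set G X \<longleftrightarrow> X \<subseteq> pverts G \<and> (\<forall>u\<in>X. \<forall>v\<in>X. (u, v) \<notin> parcs G)"

definition bipartition :: "'a pair_pre_digraph \<Rightarrow> 'a set \<Rightarrow> 'a set \<Rightarrow> bool" where
  "bipartition G A B \<longleftrightarrow> A \<union> B = pverts G \<and> A \<inter> B = {} \<and>
     independent_set G A \<and> independent_set G B"

(* Lists are indexed from 0: the set S_i shot at in round i (1 <= i <= length S) is S ! (i - 1). *)
definition hunter_strategy :: "'a pair_pre_digraph \<Rightarrow> 'a set list \<Rightarrow> bool" where
  "hunter_strategy G S \<longleftrightarrow> S \<noteq> [] \<and> (\<forall>X\<in>set S. X \<noteq> {} \<and> X \<subseteq> pverts G)"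

definition num_hunters :: "'a set list \<Rightarrow> nat" where
  "num_hunters S = Max (card ` set S)"

(* Only the values r 0, ..., r l matter. *)
definition rabbit_trajectory ::
    "'a pair_pre_digraph \<Rightarrow> 'a set \<Rightarrow> nat \<Rightarrow> (nat \<Rightarrow> 'a) \<Rightarrow> bool" where
  "rabbit_trajectory G W l r \<longleftrightarrow> r 0 \<in> W \<and> (\<forall>i\<in>{1..l}. r i \<in> nbrs G (r (i - 1)))"

definition winning :: "'a pair_pre_digraph \<Rightarrow> 'a set \<Rightarrow> 'a set list \<Rightarrow> bool" where
  "winning G W S \<longleftrightarrow>
     (\<forall>r. rabbit_trajectory G W (length S) r \<longrightarrow> (\<exists>j<length S. r j \<in> S ! j))"

primrec contaminated :: "'a pair_pre_digraph \<Rightarrow> 'a set \<Rightarrow> 'a set list \<Rightarrow> nat \<Rightarrow> 'a set" where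
  "contaminated G W S 0 = W"
| "contaminated G W S (Suc i) = {x. \<exists>y \<in> contaminated G W S i - S ! i. (x, y) \<in> parcs G}"

definition cleared_at ::
    "'a pair_pre_digraph \<Rightarrow> 'a set \<Rightarrow> 'a set list \<Rightarrow> nat \<Rightarrow> 'a \<Rightarrow> bool" where
  "cleared_at G W S i v \<longleftrightarrow>
     v \<in> S ! (i - 1) \<or>
     nbrs G v \<inter> contaminated G W S (i - 1) \<noteq> {} \<and>
     nbrs G v \<inter> contaminated G W S (i - 1) \<subseteq> S ! (i - 1)"

(* The set S_(j+1) exists only for j < length S.  For a winning strategy nothing is
   contaminated at j = length S, so this bound loses no condition. *)
definition monotone_strategy ::
    "'a pair_pre_digraph \<Rightarrow> 'a set \<Rightarrow> 'a set list \<Rightarrow> bool" where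
  "monotone_strategy G W S \<longleftrightarrow>
     (\<forall>v \<in> pverts G. \<forall>i \<in> {1..length S}. cleared_at G W S i v \<longrightarrow>
        (\<forall>j. i < j \<and> j < length S \<and> v \<in> contaminated G W S j \<longrightarrow> v \<in> S ! j))"

(* For a finite nonempty graph and W a set of vertices, both minima range over nonempty sets:
   the strategy [pverts G] is winning and monotone. *)
definition hunter_number_from :: "'a pair_pre_digraph \<Rightarrow> 'a set \<Rightarrow> nat" where
  "hunter_number_from G W =
     (LEAST k. \<exists>S. hunter_strategy G S \<and> winning G W S \<and> num_hunters S = k)"

definition hunter_number :: "'a pair_pre_digraph \<Rightarrow> nat" where
  "hunter_number G = hunter_number_from G (pverts G)"

definition monotone_hunter_number_from :: "'a pair_pre_digraph \<Rightarrow> 'a set \<Rightarrow> nat" where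
  "monotone_hunter_number_from G W =
     (LEAST k. \<exists>S. hunter_strategy G S \<and> monotone_strategy G W S \<and> winning G W S \<and>
        num_hunters S = k)"

end

theory Submission
  imports Defs "HOL-Library.Nat_Bijection"
begin

text \<open>
  The tree $T_{n+1}$ consists of a root and three limbs of very different lengths, each
  leading to a copy of $T_n$.

  Two hunters win by tolerating recontamination.  They clear the branches one after the other;
  while they are busy in the next branch, the contamination re-enters the cleared ones, but it
  advances only one edge per round.  As the limbs of the branches cleared earlier are longer than
  the time needed for the later ones, the contamination is still inside these limbs, and one
  hunter drives it back along the limb while the other one guards the root.

  A monotone strategy, on the contrary, orders the vertices by the round in which they are first
  cleared, and a cleared vertex with an uncleared neighbour has to be shot in every other round.
  Hence three times the number of hunters bounds the boundary of this order at every time, and the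
  boundary reaches size $n+1$ on $T_n$, as in the usual lower bound for the pathwidth
  of trees.
\<close>

section \<open>Contaminated sets and schedules of shots\<close>

text \<open>A trajectory steps along \<open>(r (i - 1), r i)\<close>, while contamination reads the
  arc backwards; symmetry identifies the two.\<close>

lemma contaminated_iff_trajectory:
  assumes "sym (parcs G)"
  shows "x \<in> contaminated G W S i \<longleftrightarrow>
    (\<exists>r. rabbit_trajectory G W i r \<and> r i = x \<and> (\<forall>j<i. r j \<notin> S ! j))"
proof (induction i arbitrary: x)
  case 0
  then show ?case by (auto simp: rabbit_trajectory_def)
next
  case (Suc i)
  show ?case
  proof
    assume "x \<in> contaminated G W S (Suc i)"
    then obtain y where y: "y \<in> contaminated G W S i" "y \<notin> S ! i" "(x, y) \<in> parcs G"
      by auto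
    then obtain r where r: "rabbit_trajectory G W i r" "r i = y" "\<forall>j<i. r j \<notin> S ! j"
      using Suc.IH by blast
    have "rabbit_trajectory G W (Suc i) (r(Suc i := x))"
      using r y assms by (auto simp: rabbit_trajectory_def nbrs_def le_Suc_eq dest: symD)
    then show "\<exists>r. rabbit_trajectory G W (Suc i) r \<and> r (Suc i) = x \<and> (\<forall>j<Suc i. r j \<notin> S ! j)"
      using r y by (intro exI[of _ "r(Suc i := x)"]) (auto simp: less_Suc_eq)
  next
    assume "\<exists>r. rabbit_trajectory G W (Suc i) r \<and> r (Suc i) = x \<and> (\<forall>j<Suc i. r j \<notin> S ! j)"
    then obtain r where r: "rabbit_trajectory G W (Suc i) r" "r (Suc i) = x"
      "\<forall>j<Suc i. r j \<notin> S ! j" by blast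
    have "r i \<in> contaminated G W S i"
      using r Suc.IH by (auto simp: rabbit_trajectory_def)
    moreover have "r (Suc i) \<in> nbrs G (r i)"
      using r(1) by (auto simp: rabbit_trajectory_def dest: bspec[of _ _ "Suc i"])
    ultimately show "x \<in> contaminated G W S (Suc i)"
      using r assms by (auto simp: nbrs_def dest: symD)
  qed
qed

lemma winning_iff_contaminated_empty:
  assumes "sym (parcs G)"
  shows "winning G W S \<longleftrightarrow> contaminated G W S (length S) = {}"
proof -
  have "winning G W S \<longleftrightarrow> (\<forall>x. x \<notin> contaminated G W S (length S))"
    unfolding contaminated_iff_trajectory[OF assms] winning_def by blast
  then show ?thesis by blast
qed

section \<open>The one-round transition and composable schedules\<close>

definition spread :: "'a pair_pre_digraph \<Rightarrow> 'a set \<Rightarrow> 'a set" where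
  "spread G X = {x. \<exists>y\<in>X. (x, y) \<in> parcs G}"

lemma spread_mono: "X \<subseteq> Y \<Longrightarrow> spread G X \<subseteq> spread G Y"
  by (auto simp: spread_def)

lemma contaminated_Suc: "contaminated G W S (Suc i) = spread G (contaminated G W S i - S ! i)"
  by (simp add: spread_def)

lemma contaminated_Cons:
  "contaminated G W (X # S) (Suc i) = contaminated G (spread G (W - X)) S i"
  by (induction i) (simp_all add: contaminated_Suc del: contaminated.simps(2))

lemma contaminated_append:
  "contaminated G W (S @ S') (length S + i) =
     contaminated G (contaminated G W S (length S)) S' i"
  by (induction S arbitrary: W)
    (simp_all add: contaminated_Cons del: contaminated.simps(2))

lemma contaminated_Un:
  "contaminated G (A \<union> B) S i = contaminated G A S i \<union> contaminated G B S i"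
  by (induction i) auto

lemma contaminated_mono: "A \<subseteq> B \<Longrightarrow> contaminated G A S i \<subseteq> contaminated G B S i"
  by (metis contaminated_Un sup.absorb_iff2 sup_ge1)

text \<open>Two features let schedules compose freely: shots may be empty, and \<open>B\<close> is
  only an upper bound for what stays contaminated.\<close>

inductive hunt :: "'a pair_pre_digraph \<Rightarrow> nat \<Rightarrow> nat \<Rightarrow> 'a set \<Rightarrow> 'a set \<Rightarrow> bool" for G k where
  hunt_0: "A \<subseteq> B \<Longrightarrow> hunt G k 0 A B"
| hunt_Suc: "X \<subseteq> pverts G \<Longrightarrow> card X \<le> k \<Longrightarrow> hunt G k n (spread G (A - X)) B \<Longrightarrow> hunt G k (Suc n) A B"

lemma hunt_mono: "hunt G k n A B \<Longrightarrow> A' \<subseteq> A \<Longrightarrow> B \<subseteq> B' \<Longrightarrow> hunt G k n A' B'"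
proof (induction arbitrary: A' rule: hunt.induct)
  case (hunt_0 A B)
  then show ?case by (blast intro: hunt.hunt_0)
next
  case (hunt_Suc X n A B)
  have "spread G (A' - X) \<subseteq> spread G (A - X)"
    using hunt_Suc.prems by (intro spread_mono) auto
  then show ?case using hunt_Suc by (blast intro: hunt.hunt_Suc)
qed

lemma hunt_trans: "hunt G k m A B \<Longrightarrow> hunt G k n B C \<Longrightarrow> hunt G k (m + n) A C"
proof (induction rule: hunt.induct)
  case (hunt_0 A B)
  then show ?case by (auto intro: hunt_mono)
next
  case (hunt_Suc X n A B)
  then show ?case by (auto intro: hunt.hunt_Suc)
qed

lemma hunt_step:
  "X \<subseteq> pverts G \<Longrightarrow> card X \<le> k \<Longrightarrow> spread G (A - X) \<subseteq> B \<Longrightarrow> hunt G k 1 A B"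
  using hunt_Suc[OF _ _ hunt_0] by (metis One_nat_def)

text \<open>The sets \<open>Y j\<close> confine the contamination whatever is shot, so this bound
  can be carried along with a schedule designed for another purpose.\<close>

lemma hunt_Int:
  assumes "hunt G k n A B" "\<And>j. spread G (Y j) \<subseteq> Y (Suc j)"
  shows "hunt G k n (A \<inter> Y 0) (B \<inter> Y n)"
  using assms
proof (induction arbitrary: Y rule: hunt.induct)
  case (hunt_0 A B)
  then show ?case by (auto intro: hunt.hunt_0)
next
  case (hunt_Suc X n A B)
  have "hunt G k n (spread G (A - X) \<inter> Y 1) (B \<inter> Y (Suc n))"
    using hunt_Suc.IH[of "\<lambda>j. Y (Suc j)"] hunt_Suc.prems by simp
  moreover have "spread G (A \<inter> Y 0 - X) \<subseteq> spread G (A - X) \<inter> Y 1"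
    using hunt_Suc.prems[of 0] by (auto simp: spread_def)
  ultimately have "hunt G k n (spread G (A \<inter> Y 0 - X)) (B \<inter> Y (Suc n))"
    by (blast intro: hunt_mono)
  then show ?case using hunt_Suc.hyps by (blast intro: hunt.hunt_Suc)
qed

text \<open>An empty shot is replaced by an arbitrary vertex, as additional shots only shrink the
  contaminated sets.\<close>

lemma hunt_imp_strategy:
  assumes "hunt G k n A B" "pverts G \<noteq> {}" "1 \<le> k"
  shows "\<exists>S. length S = n \<and> (\<forall>X\<in>set S. X \<noteq> {} \<and> X \<subseteq> pverts G \<and> card X \<le> k) \<and>
    contaminated G A S n \<subseteq> B"
  using assms(1)
proof (induction rule: hunt.induct)
  case (hunt_0 A B)
  then show ?case by auto
next
  case (hunt_Suc X n A B)
  then obtain S where S: "length S = n" "\<forall>X\<in>set S. X \<noteq> {} \<and> X \<subseteq> pverts G \<and> card X \<le> k"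
    "contaminated G (spread G (A - X)) S n \<subseteq> B" by blast
  obtain v where v: "v \<in> pverts G" using assms(2) by blast
  define X' where "X' = (if X = {} then {v} else X)"
  have X': "X' \<noteq> {}" "X' \<subseteq> pverts G" "card X' \<le> k" "X \<subseteq> X'"
    using hunt_Suc.hyps v assms(3) by (auto simp: X'_def)
  have "spread G (A - X') \<subseteq> spread G (A - X)"
    using X'(4) by (intro spread_mono) auto
  then have "contaminated G A (X' # S) (Suc n) \<subseteq> B"
    unfolding contaminated_Cons using contaminated_mono S(3) by blast
  then show ?case using S X' by (intro exI[of _ "X' # S"]) auto
qed

lemma num_hunters_le:
  "hunter_strategy G S \<Longrightarrow> \<forall>X\<in>set S. card X \<le> k \<Longrightarrow> num_hunters S \<le> k"
  by (auto simp: num_hunters_def hunter_strategy_def)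

lemma card_le_num_hunters: "X \<in> set S \<Longrightarrow> card X \<le> num_hunters S"
  by (simp add: num_hunters_def)

lemma hunter_number_from_eqI:
  assumes "hunter_strategy G S" "winning G W S" "num_hunters S \<le> k"
    and "\<And>S. hunter_strategy G S \<Longrightarrow> winning G W S \<Longrightarrow> k \<le> num_hunters S"
  shows "hunter_number_from G W = k"
  unfolding hunter_number_from_def
  using assms by (intro Least_equality) (metis le_antisym)+

lemma monotone_hunter_number_from_ge:
  assumes "pverts G \<noteq> {}" "W \<subseteq> pverts G"
    and "\<And>S. hunter_strategy G S \<Longrightarrow> monotone_strategy G W S \<Longrightarrow> winning G W S \<Longrightarrow> k \<le> num_hunters S"
  shows "k \<le> monotone_hunter_number_from G W"
proof -
  let ?P = "\<lambda>k. \<exists>S. hunter_strategy G S \<and> monotone_strategy G W S \<and> winning G W S \<and> num_hunters S = k"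
  have "hunter_strategy G [pverts G]" "monotone_strategy G W [pverts G]" "winning G W [pverts G]"
    using assms(1,2)
    by (auto simp: hunter_strategy_def monotone_strategy_def winning_def rabbit_trajectory_def)
  then have "?P (num_hunters [pverts G])" by blast
  then have "?P (LEAST k. ?P k)" by (rule LeastI)
  then show ?thesis using assms(3) unfolding monotone_hunter_number_from_def by metis
qed

section \<open>Spiders escape a single hunter\<close>

text \<open>The legs are \<open>c\<close>, \<open>a i\<close>, \<open>b i\<close>,
  \<open>d i\<close>. In even rounds the centre and two of the \<open>b i\<close> stay contaminated.
  If \<open>c\<close> survives the shot, it contaminates all \<open>a i\<close>; if \<open>c\<close>
  is shot, the two \<open>b i\<close> contaminate \<open>a\<close> and \<open>d\<close> on both
  legs. From either situation one shot cannot prevent the even one from returning.\<close>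

lemma one_hunter_loses_spider:
  fixes a b d :: "nat \<Rightarrow> 'a"
  assumes "sym (parcs G)"
    and arcs: "\<And>i. i < 3 \<Longrightarrow> (c, a i) \<in> parcs G \<and> (a i, b i) \<in> parcs G \<and> (b i, d i) \<in> parcs G"
    and dist: "inj_on a {..<3}" "\<And>i. i < 3 \<Longrightarrow> a i \<noteq> d i \<and> b i \<noteq> c"
    and W: "c \<in> W" "\<And>i. i < 3 \<Longrightarrow> b i \<in> W"
    and S: "\<forall>X\<in>set S. finite X \<and> card X \<le> 1"
  shows "\<not> winning G W S"
proof
  assume win: "winning G W S"
  let ?Z = "contaminated G W S"
  let ?even = "\<lambda>Z. \<exists>i<3. \<exists>j<3. i \<noteq> j \<and> {c, b i, b j} \<subseteq> Z"
  let ?odd = "\<lambda>Z. (\<forall>i<3. a i \<in> Z) \<or> (\<exists>i<3. \<exists>j<3. i \<noteq> j \<and> {a i, a j, d i, d j} \<subseteq> Z)"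
  have arcs': "(a i, c) \<in> parcs G" "(b i, a i) \<in> parcs G" "(d i, b i) \<in> parcs G"
    "(c, a i) \<in> parcs G" "(a i, b i) \<in> parcs G" "(b i, d i) \<in> parcs G" if "i < 3" for i
    using arcs[OF that] assms(1) by (auto dest: symD)
  have into: "w \<in> spread G (Z - {x})" if "y \<in> Z" "y \<noteq> x" "(w, y) \<in> parcs G" for w x y Z
    using that by (auto simp: spread_def)
  have even_odd: "?odd (spread G (Z - {x}))" if even: "?even Z" for Z x
  proof (cases "x = c")
    case True
    obtain i j where ij: "i < 3" "j < 3" "i \<noteq> j" "{c, b i, b j} \<subseteq> Z" using even by blast
    then have "b i \<in> Z" "b i \<noteq> x" "b j \<in> Z" "b j \<noteq> x" using dist(2) True by auto
    then have "{a i, a j, d i, d j} \<subseteq> spread G (Z - {x})"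
      using into arcs'[OF ij(1)] arcs'[OF ij(2)] by simp
    then show ?thesis using ij by blast
  next
    case False
    have "c \<in> Z" using even by blast
    then show ?thesis using into[of c Z x] arcs' False by simp
  qed
  have odd_even: "?even (spread G (Z - {x}))" if "?odd Z" for Z x
    using that
  proof
    assume all: "\<forall>i<3. a i \<in> Z"
    have ne: "a 0 \<noteq> a 1" "a 0 \<noteq> a 2" "a 1 \<noteq> a 2"
      using dist(1) by (auto dest!: inj_onD)
    have *: ?thesis if "i < 3" "j < 3" "i \<noteq> j" "a i \<noteq> x" "a j \<noteq> x" for i j
    proof -
      have "{c, b i, b j} \<subseteq> spread G (Z - {x})"
        using that all into[of "a i" Z x] into[of "a j" Z x] arcs'[OF that(1)] arcs'[OF that(2)] by simp
      then show ?thesis using that(1-3) by (intro exI[of _ i] exI[of _ j] conjI)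
    qed
    consider "a 0 \<noteq> x" "a 1 \<noteq> x" | "a 0 \<noteq> x" "a 2 \<noteq> x" | "a 1 \<noteq> x" "a 2 \<noteq> x"
      using ne by metis
    then show ?thesis by cases (rule *; simp)+
  next
    assume "\<exists>i<3. \<exists>j<3. i \<noteq> j \<and> {a i, a j, d i, d j} \<subseteq> Z"
    then obtain i j where ij: "i < 3" "j < 3" "i \<noteq> j" "{a i, a j, d i, d j} \<subseteq> Z" by blast
    then have "a i \<noteq> a j" using dist(1) by (auto dest!: inj_onD)
    moreover have "a i \<noteq> d i" "a j \<noteq> d j" using dist(2) ij by auto
    ultimately have "{c, b i, b j} \<subseteq> spread G (Z - {x})"
      using ij(4) into[of _ Z x] arcs'[OF ij(1)] arcs'[OF ij(2)] by (cases "a i = x"; cases "a j = x") auto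
    then show ?thesis using ij(1-3) by (intro exI[of _ i] exI[of _ j] conjI)
  qed
  \<comment> \<open>A shot at no vertex is dominated by a shot at an arbitrary one, so singletons
    suffice.\<close>
  have shot: "\<exists>x. spread G (Z - {x}) \<subseteq> spread G (Z - S ! n)" if "n < length S" for n Z
  proof -
    have "finite (S ! n)" "card (S ! n) \<le> 1" using S that by auto
    then obtain x where "S ! n \<subseteq> {x}"
      by (cases "S ! n = {}") (auto simp: card_le_Suc0_iff_eq)
    then show ?thesis by (intro exI[of _ x] spread_mono) auto
  qed
  have mono: "?even Z \<Longrightarrow> Z \<subseteq> Z' \<Longrightarrow> ?even Z'" "?odd Z \<Longrightarrow> Z \<subseteq> Z' \<Longrightarrow> ?odd Z'" for Z Z'
    by (meson subset_trans, meson subset_trans subsetD)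
  have inv: "if even n then ?even (?Z n) else ?odd (?Z n)" if "n \<le> length S" for n
    using that
  proof (induction n)
    case 0
    have "{c, b 0, b 1} \<subseteq> W" using W by auto
    then have "?even (?Z 0)" by (intro exI[of _ 0] exI[of _ 1] conjI) auto
    then show ?case by simp
  next
    case (Suc n)
    obtain x where x: "spread G (?Z n - {x}) \<subseteq> ?Z (Suc n)"
      using shot[of n "?Z n"] Suc.prems unfolding contaminated_Suc by auto
    show ?case
    proof (cases "even n")
      case True
      then show ?thesis using Suc even_odd[of "?Z n" x] mono(2)[OF _ x] by simp
    next
      case False
      then show ?thesis using Suc odd_even[of "?Z n" x] mono(1)[OF _ x] by simp
    qed
  qed
  have "?Z (length S) \<noteq> {}"
  proof (cases "even (length S)")
    case True
    then show ?thesis using inv[of "length S"] by auto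
  next
    case False
    then have "?odd (?Z (length S))" using inv[of "length S"] by simp
    then show ?thesis by (auto dest: spec[of _ 0])
  qed
  then show False using win winning_iff_contaminated_empty[OF assms(1)] by blast
qed

section \<open>Clearing times of a monotone strategy\<close>

text \<open>An isolated vertex of \<open>B\<close> could only be cleared by a direct shot; excluding
  isolated vertices ensures that a winning strategy clears every vertex at some round.\<close>

locale monotone_hunt =
  fixes G :: "'a pair_pre_digraph" and A B :: "'a set" and S :: "'a set list"
  assumes sym: "sym (parcs G)" and arcs_in: "parcs G \<subseteq> pverts G \<times> pverts G"
    and bip: "bipartition G A B"
    and no_isolated: "\<And>v. v \<in> pverts G \<Longrightarrow> nbrs G v \<noteq> {}"
    and strategy: "hunter_strategy G S"
    and mono: "monotone_strategy G A S"
    and win: "winning G A S"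
begin

abbreviation Z where "Z \<equiv> contaminated G A S"

text \<open>The class in which a rabbit starting in \<open>A\<close> sits after \<open>j\<close>
  moves.\<close>

definition side :: "nat \<Rightarrow> 'a set" where
  "side j = (if even j then A else B)"

lemma side_Suc: "v \<in> pverts G \<Longrightarrow> v \<in> side (Suc j) \<longleftrightarrow> v \<notin> side j"
  using bip by (auto simp: side_def bipartition_def)

lemma side_arc:
  assumes "(u, v) \<in> parcs G"
  shows "u \<in> side j \<longleftrightarrow> v \<notin> side j"
proof -
  have "u \<in> A \<union> B" "v \<in> A \<union> B" using assms arcs_in bip by (auto simp: bipartition_def)
  moreover have "\<not> (u \<in> A \<and> v \<in> A)" "\<not> (u \<in> B \<and> v \<in> B)" "A \<inter> B = {}"
    using assms bip by (auto simp: bipartition_def independent_set_def)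
  ultimately show ?thesis by (auto simp: side_def)
qed

lemma Z_subset_side: "Z j \<subseteq> side j"
proof (induction j)
  case 0
  then show ?case by (simp add: side_def)
next
  case (Suc j)
  show ?case
  proof
    fix x assume "x \<in> Z (Suc j)"
    then obtain y where y: "y \<in> Z j" "(x, y) \<in> parcs G" by auto
    then have "x \<notin> side j" "x \<in> pverts G" using Suc side_arc[of x y j] arcs_in by auto
    then show "x \<in> side (Suc j)" by (simp add: side_Suc)
  qed
qed

text \<open>Induction in steps of two: an unshot \<open>v\<close> contaminates its neighbours, and
  since \<open>v\<close> is not cleared in the next round either, one of them survives and
  contaminates \<open>v\<close> again. For odd \<open>j\<close> the process starts from a neighbour
  in \<open>A\<close>.\<close>

lemma uncleared_in_Z:
  assumes "v \<in> pverts G" "\<And>i. 1 \<le> i \<Longrightarrow> i \<le> j \<Longrightarrow> \<not> cleared_at G A S i v" "v \<in> side j"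
  shows "v \<in> Z j"
  using assms
proof (induction j rule: induct_nat_012)
  case 0
  then show ?case by (simp add: side_def)
next
  case 1
  obtain w where w: "w \<in> nbrs G v" using no_isolated 1 by blast
  then have "w \<in> Z 0" using side_arc[of v w 0] side_Suc[of v 0] 1 by (auto simp: nbrs_def side_def)
  then show ?case
    using w 1(2)[of 1] by (auto simp: cleared_at_def nbrs_def)
next
  case (ge2 j)
  have "v \<in> side j" using ge2.prems by (simp add: side_Suc)
  then have "v \<in> Z j" using ge2 by auto
  moreover have "v \<notin> S ! j" using ge2.prems(2)[of "Suc j"] by (auto simp: cleared_at_def)
  moreover obtain w where w: "w \<in> nbrs G v" using no_isolated ge2.prems by blast
  ultimately have "w \<in> Z (Suc j)" using sym by (auto simp: nbrs_def dest: symD)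
  then obtain y where "y \<in> nbrs G v" "y \<in> Z (Suc j)" "y \<notin> S ! Suc j"
    using w ge2.prems(2)[of "Suc (Suc j)"] by (auto simp: cleared_at_def simp del: contaminated.simps)
  then show ?case by (auto simp: nbrs_def simp del: contaminated.simps simp: contaminated.simps(2)[of _ _ _ "Suc j"])
qed

lemma Z_length: "Z (length S) = {}"
  using win winning_iff_contaminated_empty[OF sym] by blast

lemma eventually_cleared:
  assumes "v \<in> pverts G"
  shows "\<exists>i. 1 \<le> i \<and> i \<le> length S \<and> cleared_at G A S i v"
proof (rule ccontr)
  assume *: "\<not> ?thesis"
  obtain l where l: "length S = Suc l"
    using strategy by (cases S) (auto simp: hunter_strategy_def)
  \<comment> \<open>Nothing is contaminated at the end, so parity puts a never cleared
    \<open>v\<close> in the set one round earlier, from where it would contaminate a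
    neighbour.\<close>
  have "v \<notin> side (Suc l)"
    using uncleared_in_Z[OF assms, of "Suc l"] * Z_length l by auto
  then have "v \<in> side l" using assms by (simp add: side_Suc)
  then have "v \<in> Z l" using uncleared_in_Z[OF assms, of l] * l by auto
  moreover have "v \<notin> S ! l" using * l by (auto simp: cleared_at_def dest: spec[of _ "Suc l"])
  moreover obtain w where "w \<in> nbrs G v" using no_isolated assms by blast
  ultimately have "w \<in> Z (Suc l)" using sym by (auto simp: nbrs_def dest: symD)
  then show False using Z_length l by simp
qed

text \<open>The bound \<open>1 \<le> i\<close> excludes the spurious round 0, where
  \<open>i - 1\<close> truncates and \<open>cleared_at\<close> repeats round 1.\<close>

definition ctime :: "'a \<Rightarrow> nat" where
  "ctime v = (LEAST i. 1 \<le> i \<and> cleared_at G A S i v)"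

lemma ctime:
  assumes "v \<in> pverts G"
  shows "1 \<le> ctime v" "ctime v \<le> length S" "cleared_at G A S (ctime v) v"
proof -
  obtain i where i: "1 \<le> i" "i \<le> length S" "cleared_at G A S i v"
    using eventually_cleared[OF assms] by blast
  then have "1 \<le> ctime v \<and> cleared_at G A S (ctime v) v"
    unfolding ctime_def using LeastI[of "\<lambda>i. 1 \<le> i \<and> cleared_at G A S i v" i] by simp
  moreover have "ctime v \<le> i"
    unfolding ctime_def using i Least_le[of "\<lambda>i. 1 \<le> i \<and> cleared_at G A S i v" i] by simp
  ultimately show "1 \<le> ctime v" "ctime v \<le> length S" "cleared_at G A S (ctime v) v"
    using i by auto
qed

lemma not_cleared_before: "1 \<le> i \<Longrightarrow> i < ctime v \<Longrightarrow> \<not> cleared_at G A S i v"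
  unfolding ctime_def using not_less_Least by blast

text \<open>As long as \<^term>\<open>v\<close> is uncleared, it contaminates \<^term>\<open>u\<close> in every other round, so that
  monotonicity forces the shots at \<^term>\<open>u\<close>.\<close>
lemma boundary_shot:
  assumes uv: "(u, v) \<in> parcs G" and t: "ctime u \<le> t" "t < ctime v"
  shows "u \<in> S ! (t - 2) \<union> S ! (t - 1) \<union> S ! t"
proof -
  have V: "u \<in> pverts G" "v \<in> pverts G" using uv arcs_in by auto
  have vu: "(v, u) \<in> parcs G" using uv sym by (auto dest: symD)
  have v_Z: "v \<in> Z j" if "j \<le> t" "v \<in> side j" for j
    using uncleared_in_Z[OF V(2) _ that(2)] not_cleared_before[of _ v] t that by auto
  show ?thesis
  proof (cases "t \<le> ctime u + 1")
    case True
    let ?c = "ctime u"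
    \<comment> \<open>Otherwise \<open>u\<close> is cleared by shooting all its contaminated
      neighbours. By parity \<open>v\<close> is one of them, and being shot it would be cleared too
      early.\<close>
    have "u \<in> S ! (?c - 1)"
    proof (rule ccontr)
      assume "u \<notin> S ! (?c - 1)"
      then have ne: "nbrs G u \<inter> Z (?c - 1) \<noteq> {}" and sub: "nbrs G u \<inter> Z (?c - 1) \<subseteq> S ! (?c - 1)"
        using ctime(3)[OF V(1)] by (auto simp: cleared_at_def)
      then obtain w where "(u, w) \<in> parcs G" "w \<in> side (?c - 1)"
        using Z_subset_side by (auto simp: nbrs_def)
      then have "v \<in> side (?c - 1)" using side_arc uv by blast
      then have "v \<in> Z (?c - 1)" using v_Z t by simp
      then have "v \<in> S ! (?c - 1)" using sub uv by (auto simp: nbrs_def)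
      then show False using not_cleared_before[of ?c v] ctime(1)[OF V(1)] t
        by (auto simp: cleared_at_def)
    qed
    moreover have "?c = t \<or> ?c - 1 = t - 2" using True t by auto
    ultimately show ?thesis by auto
  next
    case False
    then obtain s where s: "t = Suc s" by (cases t) auto
    \<comment> \<open>Of two consecutive rounds, parity admits contamination of \<open>u\<close> in
      exactly one.\<close>
    obtain j where j: "j = s \<or> j = t" "u \<in> side j"
      using side_Suc[OF V(1), of s] s by metis
    then obtain i where i: "j = Suc i" using False s by (cases j) auto
    have "v \<in> side i" using side_arc[OF uv, of i] j i V by (simp add: side_Suc)
    then have "v \<in> Z i" using v_Z j i s by auto
    moreover have "v \<notin> S ! i"
      using not_cleared_before[of j v] j i s t by (auto simp: cleared_at_def)
    ultimately have "u \<in> Z j" using uv i by auto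
    moreover have "ctime u < j" "j < length S"
      using j s False t ctime(2)[OF V(2)] by auto
    ultimately have "u \<in> S ! j"
      using mono V ctime[OF V(1)] unfolding monotone_strategy_def by fastforce
    then show ?thesis using j s by auto
  qed
qed

text \<open>The boundary lies in three shots, whence the factor 3. A crossing edge forces
  \<open>t\<close> below the length of \<open>S\<close>, so these shots exist; without one the
  boundary is empty.\<close>

lemma card_boundary:
  assumes "finite (pverts G)" "F \<subseteq> pverts G" 
  shows "card {u \<in> F. ctime u \<le> t \<and> (\<exists>v\<in>F. (u, v) \<in> parcs G \<and> t < ctime v)} \<le> 3 * num_hunters S"
proof (cases "\<exists>u\<in>F. \<exists>v\<in>F. (u, v) \<in> parcs G \<and> t < ctime v")
  case True
  then have l: "t < length S" using ctime(2) assms(2) by fastforce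
  have fin: "finite (S ! i) \<and> card (S ! i) \<le> num_hunters S" if "i < length S" for i
    using card_le_num_hunters[OF nth_mem[OF that]] strategy assms(1) nth_mem[OF that]
    by (meson finite_subset hunter_strategy_def)
  let ?U = "S ! (t - 2) \<union> S ! (t - 1) \<union> S ! t"
  have "{u \<in> F. ctime u \<le> t \<and> (\<exists>v\<in>F. (u, v) \<in> parcs G \<and> t < ctime v)} \<subseteq> ?U"
    using boundary_shot by blast
  moreover have "finite ?U" using fin l by auto
  ultimately have "card {u \<in> F. ctime u \<le> t \<and> (\<exists>v\<in>F. (u, v) \<in> parcs G \<and> t < ctime v)} \<le> card ?U"
    by (rule card_mono[rotated])
  also have "\<dots> \<le> card (S ! (t - 2)) + card (S ! (t - 1)) + card (S ! t)"
    by (meson add_le_mono card_Un_le le_refl order_trans)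
  also have "\<dots> \<le> 3 * num_hunters S"
    using fin[of "t - 2"] fin[of "t - 1"] fin[of t] l by linarith
  finally show ?thesis .
next
  case False
  then have empty: "{u \<in> F. ctime u \<le> t \<and> (\<exists>v\<in>F. (u, v) \<in> parcs G \<and> t < ctime v)} = {}" by blast
  show ?thesis unfolding empty by simp
qed

text \<open>Vertices in the class contaminated just before round \<open>t\<close> have no
  contaminated neighbours, so they can be cleared in that round only by being shot
  themselves.\<close>

lemma simultaneously_cleared:
  assumes "finite (pverts G)" "F \<subseteq> pverts G" "\<And>v. v \<in> F \<Longrightarrow> ctime v = t"
  shows "card (F \<inter> A) \<le> num_hunters S \<or> card (F \<inter> B) \<le> num_hunters S"
proof (cases "F = {}")
  case True
  then show ?thesis by simp
next
  case False
  then have t: "1 \<le> t" "t \<le> length S" using ctime assms by blast+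
  have sub: "F \<inter> side (t - 1) \<subseteq> S ! (t - 1)"
  proof
    fix v assume v: "v \<in> F \<inter> side (t - 1)"
    have False if "w \<in> nbrs G v" "w \<in> Z (t - 1)" for w
      using that v Z_subset_side side_arc by (auto simp: nbrs_def)
    then show "v \<in> S ! (t - 1)"
      using ctime(3)[of v] v assms(2,3) by (auto simp: cleared_at_def)
  qed
  have "S ! (t - 1) \<in> set S" using t by auto
  then have "card (F \<inter> side (t - 1)) \<le> num_hunters S"
    using sub card_le_num_hunters strategy assms(1)
    by (meson card_mono finite_subset hunter_strategy_def order_trans)
  then show ?thesis by (auto simp: side_def split: if_splits)
qed

end

section \<open>Trees inside the universal rooted tree on the naturals\<close>

text \<open>Every nonzero number is \<open>child b q\<close> for exactly one pair, and exceeds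
  \<open>q\<close>. The naturals thus form a tree with root 0 in which each vertex has one child for
  every label \<open>b\<close>.\<close>

definition child :: "nat \<Rightarrow> nat \<Rightarrow> nat" where
  "child b q = Suc (prod_encode (b, q))"

definition par :: "nat \<Rightarrow> nat" where
  "par x = snd (prod_decode (x - 1))"

lemma par_child [simp]: "par (child b q) = q"
  by (simp add: par_def child_def)

lemma child_eq_iff [simp]: "child b p = child c q \<longleftrightarrow> b = c \<and> p = q"
  by (simp add: child_def)

lemma less_child [simp]: "q < child b q"
  by (simp add: child_def le_imp_less_Suc le_prod_encode_2)

lemma child_neq [simp]: "child b q \<noteq> q" "q \<noteq> child b q" "child b q \<noteq> 0"
  using less_child[of q b] by (auto simp del: less_child)

lemma ex_child: "x \<noteq> 0 \<Longrightarrow> \<exists>b. x = child b (par x)"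
  unfolding child_def par_def
  by (metis One_nat_def Suc_pred bot_nat_0.not_eq_extremum prod.collapse prod_decode_inverse)

lemma par_less: "x \<noteq> 0 \<Longrightarrow> par x < x"
  using ex_child less_child by metis

inductive_set desc :: "nat \<Rightarrow> nat set" for q where
  desc_refl [simp, intro]: "q \<in> desc q"
| desc_child [intro]: "x \<in> desc q \<Longrightarrow> child b x \<in> desc q"

lemma desc_trans: "x \<in> desc p \<Longrightarrow> p \<in> desc q \<Longrightarrow> x \<in> desc q"
  by (induction rule: desc.induct) auto

lemma desc_ge: "x \<in> desc q \<Longrightarrow> q \<le> x"
  by (induction rule: desc.induct) (auto intro: le_trans less_imp_le[OF less_child])

lemma desc_childD: "child b x \<in> desc q \<Longrightarrow> child b x = q \<or> x \<in> desc q"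
  by (erule desc.cases) auto

lemma not_in_desc_child [simp]: "q \<notin> desc (child b q)"
  using desc_ge less_child leD by blast

lemma desc_child_subset: "desc (child b q) \<subseteq> desc q"
  using desc_trans by blast

lemma desc_child_disjoint: "x \<in> desc (child b q) \<Longrightarrow> b \<noteq> c \<Longrightarrow> x \<notin> desc (child c q)"
proof (induction rule: desc.induct)
  case desc_refl
  then show ?case using desc_childD[of b q "child c q"] by auto
next
  case (desc_child x d)
  then show ?case using desc_childD[of d x "child c q"] by auto
qed

lemma desc_0: "x \<in> desc 0"
proof (induction x rule: less_induct)
  case (less x)
  show ?case
  proof (cases "x = 0")
    case False
    then show ?thesis using less par_less ex_child desc_child by metis
  qed auto
qed

function even_depth :: "nat \<Rightarrow> bool" where
  "even_depth x = (if x = 0 then True else \<not> even_depth (par x))"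
  by pat_completeness auto
termination by (relation "measure id") (auto simp: par_less)

declare even_depth.simps [simp del]

lemma even_depth_0 [simp]: "even_depth 0"
  by (simp add: even_depth.simps)

lemma even_depth_child [simp]: "even_depth (child b q) \<longleftrightarrow> \<not> even_depth q"
  by (subst even_depth.simps) simp

section \<open>Finite subtrees as graphs\<close>

definition edges :: "nat set \<Rightarrow> nat rel" where
  "edges V = {(x, y). x \<in> V \<and> y \<in> V \<and> (\<exists>b. y = child b x \<or> x = child b y)}"

definition graph_on :: "nat set \<Rightarrow> nat pair_pre_digraph" where
  "graph_on V = \<lparr>pverts = V, parcs = edges V\<rparr>"

lemma graph_on_simps [simp]: "pverts (graph_on V) = V" "parcs (graph_on V) = edges V"
  by (simp_all add: graph_on_def)

lemma sym_edges: "sym (edges V)"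
  by (auto simp: edges_def sym_def)

lemma edges_even_depth: "(x, y) \<in> edges V \<Longrightarrow> even_depth y \<longleftrightarrow> \<not> even_depth x"
  by (auto simp: edges_def)

text \<open>Both the slow leak into a limb and the guarding of a branch by a single vertex rest on
  this.\<close>

lemma edges_desc_child:
  "(x, y) \<in> edges V \<Longrightarrow> x \<in> desc (child b p) \<Longrightarrow> y \<in> desc (child b p) \<or> x = child b p \<and> y = p"
  unfolding edges_def using desc_childD by fastforce

lemma bipartition_graph_on:
  "bipartition (graph_on V) {x \<in> V. even_depth x} {x \<in> V. \<not> even_depth x}"
  by (auto simp: bipartition_def independent_set_def dest: edges_even_depth)

lemma edges_less_imp_par: "(x, y) \<in> edges V \<Longrightarrow> y < x \<Longrightarrow> y = par x"
  using less_child order.asym by (fastforce simp: edges_def)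

lemma pcas_nth:
  "pcas u p v \<Longrightarrow> Suc i < length p \<Longrightarrow> fst (p ! Suc i) = snd (p ! i)"
proof (induction p arbitrary: u i)
  case (Cons e p)
  then show ?case by (cases p; cases i) auto
qed simp

lemma pcas_last: "pcas u p v \<Longrightarrow> p \<noteq> [] \<Longrightarrow> snd (last p) = v \<and> fst (hd p) = u"
  by (induction p arbitrary: u) (auto split: if_splits)

text \<open>The largest vertex of a cycle has two smaller neighbours, but only its parent is available.\<close>
lemma no_cycle_graph_on:
  assumes "pre_digraph.cycle (with_proj (graph_on V)) p"
  shows "length p < 3"
proof (rule ccontr)
  assume len: "\<not> length p < 3"
  let ?n = "length p"
  obtain u where u: "set p \<subseteq> edges V" "pcas u p u" "distinct (tl (pawalk_verts u p))"
    using assms unfolding pre_digraph.cycle_def pre_digraph.awalk_def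
    by (auto simp: cas_with_proj_eq awalk_verts_with_proj_eq)
  have "pcas v q w \<Longrightarrow> pawalk_verts v q = v # map snd q" for v q w
    by (induction q arbitrary: v) auto
  then have "pawalk_verts u p = u # map snd p" using u(2) .
  then have dist: "distinct (map snd p)" using u(3) by simp
  define nxt where "nxt i = (if Suc i = ?n then 0 else Suc i)" for i
  have nxt: "nxt i < ?n" "fst (p ! nxt i) = snd (p ! i)" if "i < ?n" for i
  proof -
    have "p \<noteq> []" using len by auto
    then have "fst (p ! 0) = snd (p ! (?n - 1))"
      using pcas_last[OF u(2)] by (simp add: hd_conv_nth last_conv_nth)
    moreover have "i = ?n - 1" if "Suc i = ?n" using that by simp
    ultimately show "fst (p ! nxt i) = snd (p ! i)"
      using that pcas_nth[OF u(2), of i] by (auto simp: nxt_def)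
    show "nxt i < ?n" using that by (auto simp: nxt_def)
  qed
  \<comment> \<open>\<open>i\<close> is the arc of the cycle ending in the largest vertex,
    \<open>h\<close> the arc before it.\<close>
  let ?M = "Max (set (map snd p))"
  have "?M \<in> set (map snd p)" using len by (intro Max_in) auto
  then obtain i where i: "i < ?n" "snd (p ! i) = ?M" by (auto simp: in_set_conv_nth)
  obtain h where h: "h < ?n" "nxt h = i"
  proof (cases i)
    case 0
    then show ?thesis using that[of "?n - 1"] i by (auto simp: nxt_def)
  next
    case (Suc j)
    then show ?thesis using that[of j] i by (auto simp: nxt_def)
  qed
  have arc: "(fst (p ! k), snd (p ! k)) \<in> edges V" if "k < ?n" for k
    using u(1) that by auto
  have le: "snd (p ! k) \<le> ?M" if "k < ?n" for k using that by (intro Max_ge) auto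
  have irr: "(x, x) \<notin> edges V" for x by (auto simp: edges_def)
  have "(?M, snd (p ! h)) \<in> edges V"
    using arc[OF i(1)] i nxt(2)[OF h(1)] h sym_edges by (auto dest: symD)
  moreover have "(?M, snd (p ! nxt i)) \<in> edges V"
    using arc[OF nxt(1)[OF i(1)]] nxt(2)[OF i(1)] i by simp
  ultimately have "snd (p ! h) = par ?M" "snd (p ! nxt i) = par ?M"
    using edges_less_imp_par le[OF h(1)] le[OF nxt(1)[OF i(1)]] irr
    by (metis le_neq_implies_less)+
  \<comment> \<open>Predecessor and successor of \<open>i\<close> coincide, which is impossible on a
    cycle of length at least 3.\<close>
  then have "h = nxt i"
    using dist h(1) nxt(1)[OF i(1)] by (metis length_map nth_eq_iff_index_eq nth_map)
  then show False using h i len by (auto simp: nxt_def split: if_splits)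
qed

text \<open>A finite set containing the root and closed under parents is the vertex set of a
  connected subtree.\<close>

locale rooted =
  fixes V :: "nat set"
  assumes finite_V [simp]: "finite V" and root_in [simp]: "0 \<in> V"
    and child_inD: "\<And>b x. child b x \<in> V \<Longrightarrow> x \<in> V"
begin

lemma V_nonempty [simp]: "V \<noteq> {}"
  using root_in by blast

lemma finite_edges: "finite (edges V)"
  by (rule finite_subset[of _ "V \<times> V"]) (auto simp: edges_def)

lemma pair_graph_graph_on: "pair_graph (graph_on V)"
proof -
  have "symmetric (with_proj (graph_on V))"
    using sym_edges by (simp add: symmetric_def)
  moreover have "x \<noteq> y" if "(x, y) \<in> edges V" for x y
    using that by (auto simp: edges_def)
  moreover have "x \<in> V \<and> y \<in> V" if "(x, y) \<in> edges V" for x y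
    using that by (simp add: edges_def)
  ultimately show ?thesis
    using finite_edges by unfold_locales (simp_all, force+)
qed

lemma root_rtrancl: "x \<in> V \<Longrightarrow> (0, x) \<in> (edges V)\<^sup>*"
proof (induction x rule: less_induct)
  case (less x)
  show ?case
  proof (cases "x = 0")
    case False
    then have p: "par x < x" "par x \<in> V" "(par x, x) \<in> edges V"
      using ex_child[OF False] par_less child_inD less.prems by (auto simp: edges_def) metis+
    then show ?thesis using less.IH by (blast intro: rtrancl_into_rtrancl)
  qed simp
qed

lemma undirected_tree_graph_on: "undirected_tree (graph_on V)"
proof -
  interpret pair_graph "graph_on V" by (rule pair_graph_graph_on)
  have "x \<rightarrow>\<^sup>*\<^bsub>graph_on V\<^esub> y" if "x \<in> V" "y \<in> V" for x y
  proof -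
    have "(x, 0) \<in> (edges V)\<^sup>*"
      using root_rtrancl[OF that(1)] sym_edges sym_rtrancl by (metis symD)
    then have "(x, y) \<in> (edges V)\<^sup>*" using root_rtrancl[OF that(2)] by (rule rtrancl_trans)
    then show ?thesis using reachable_conv[of x y] that by simp
  qed
  then have "Digraph_Component.connected (with_proj (graph_on V))"
    unfolding Digraph_Component.connected_def
    by (intro strongly_connectedI) (auto intro: reachable_mk_symmetricI)
  then show ?thesis
    using pair_graph_graph_on no_cycle_graph_on unfolding undirected_tree_def by fastforce
qed

end

section \<open>Clearing subtrees with two hunters\<close>

text \<open>A tree shape is a function from the position of its root to its vertex set, so that
  copies can be placed anywhere. Here a path with \<open>m\<close> edges leads from \<open>q\<close>
  to the root of a copy of \<open>F\<close>.\<close>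

primrec limb :: "nat \<Rightarrow> (nat \<Rightarrow> nat set) \<Rightarrow> nat \<Rightarrow> nat set" where
  "limb 0 F q = F q"
| "limb (Suc m) F q = insert q (limb m F (child 0 q))"

definition limb_vertex :: "nat \<Rightarrow> nat \<Rightarrow> nat" where
  "limb_vertex q s = (child 0 ^^ s) q"

lemma limb_vertex_0 [simp]: "limb_vertex q 0 = q"
  and limb_vertex_Suc: "limb_vertex q (Suc s) = child 0 (limb_vertex q s)"
  by (simp_all add: limb_vertex_def)

lemma limb_vertex_child: "limb_vertex (child 0 q) s = limb_vertex q (Suc s)"
  by (simp add: limb_vertex_def funpow_swap1)

lemma limb_conv: "limb m F q = limb_vertex q ` {..<m} \<union> F (limb_vertex q m)"
proof (induction m arbitrary: q)
  case (Suc m)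
  have "limb_vertex q ` {..<Suc m} = insert q (limb_vertex (child 0 q) ` {..<m})"
    unfolding lessThan_Suc_eq_insert_0 by (auto simp: limb_vertex_child image_image)
  then show ?case using Suc[of "child 0 q"] by (simp add: limb_vertex_child)
qed simp

definition subtrees :: "(nat \<Rightarrow> nat set) \<Rightarrow> bool" where
  "subtrees F \<longleftrightarrow> (\<forall>q. finite (F q) \<and> q \<in> F q \<and> F q \<subseteq> desc q \<and>
     (\<forall>b x. child b x \<in> F q \<longrightarrow> child b x \<noteq> q \<longrightarrow> x \<in> F q))"

lemma subtreesD:
  assumes "subtrees F"
  shows "finite (F q)" "q \<in> F q" "F q \<subseteq> desc q"
    "child b x \<in> F q \<Longrightarrow> child b x \<noteq> q \<Longrightarrow> x \<in> F q"
  using assms unfolding subtrees_def by blast+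

lemma subtrees_singleton: "subtrees (\<lambda>q. {q})"
  by (auto simp: subtrees_def)

lemma subtrees_limb:
  assumes "subtrees F"
  shows "subtrees (limb m F)"
proof (induction m)
  case 0
  then show ?case using assms by (simp add: subtrees_def)
next
  case (Suc m)
  note D = subtreesD[OF Suc]
  have "insert q (limb m F (child 0 q)) \<subseteq> desc q" for q
    using D(3) desc_child_subset by blast
  moreover have "x \<in> insert q (limb m F (child 0 q))"
    if "child b x \<in> insert q (limb m F (child 0 q))" "child b x \<noteq> q" for b x q
    using that D(4)[of b x "child 0 q"] by auto
  ultimately show ?case using D(1) by (simp add: subtrees_def)
qed

definition join :: "(nat \<Rightarrow> nat \<Rightarrow> nat set) \<Rightarrow> nat \<Rightarrow> nat set" where
  "join F q = insert q (\<Union>b<3. F b (child b q))"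

lemma subtrees_join:
  assumes "\<And>b. b < 3 \<Longrightarrow> subtrees (F b)"
  shows "subtrees (join F)"
proof -
  note D = subtreesD[OF assms]
  have "F b (child b q) \<subseteq> desc q" if "b < 3" for b q
    by (rule subset_trans[OF D(3)[OF that] desc_child_subset])
  then have "join F q \<subseteq> desc q" for q
    by (auto simp: join_def)
  moreover have "x \<in> join F q" if x: "child b x \<in> join F q" "child b x \<noteq> q" for b x q
  proof -
    obtain c where c: "c < 3" "child b x \<in> F c (child c q)" using x by (auto simp: join_def)
    show ?thesis
    proof (cases "child b x = child c q")
      case True
      then show ?thesis by (simp add: join_def)
    next
      case False
      then have "x \<in> F c (child c q)" by (rule D(4)[OF c])
      then show ?thesis using c by (auto simp: join_def)
    qed
  qed
  moreover have "finite (join F q)" for q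
    using D(1) by (auto simp: join_def)
  ultimately show ?thesis by (simp add: subtrees_def join_def)
qed

text \<open>An equation for \<open>V \<inter> desc q\<close> says that the given shape is all that
  \<open>V\<close> contains below \<open>q\<close>. This information is passed down to the
  branches.\<close>

lemma desc_Int_limb:
  assumes "subtrees F" "V \<inter> desc q = limb (Suc m) F q"
  shows "V \<inter> desc (child 0 q) = limb m F (child 0 q)"
proof -
  have "V \<inter> desc (child 0 q) = insert q (limb m F (child 0 q)) \<inter> desc (child 0 q)"
    using assms(2) desc_child_subset by fastforce
  then show ?thesis using subtreesD(3)[OF subtrees_limb[OF assms(1)]] by auto
qed

lemma desc_Int_limb_vertex:
  assumes "subtrees F" "V \<inter> desc q = limb L F q" "s \<le> L"
  shows "V \<inter> desc (limb_vertex q s) = limb (L - s) F (limb_vertex q s)"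
  using assms(3)
proof (induction s)
  case 0
  then show ?case using assms(2) by simp
next
  case (Suc s)
  then have "L - s = Suc (L - Suc s)" by simp
  then show ?case using Suc desc_Int_limb[OF assms(1)] unfolding limb_vertex_Suc by simp
qed

lemma desc_Int_join:
  assumes "\<And>b. b < 3 \<Longrightarrow> subtrees (F b)" "V \<inter> desc q = join F q" "b < 3"
  shows "V \<inter> desc (child b q) = F b (child b q)"
proof -
  have sub: "F c (child c q) \<subseteq> desc (child c q)" if "c < 3" for c
    using subtreesD(3)[OF assms(1)[OF that]] .
  have "V \<inter> desc (child b q) = join F q \<inter> desc (child b q)"
    using assms(2) desc_child_subset by fastforce
  also have "\<dots> = F b (child b q)"
    using sub assms(3) desc_child_disjoint[of _ _ q b] by (fastforce simp: join_def)
  finally show ?thesis .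
qed

context rooted
begin

abbreviation "hunt2 \<equiv> hunt (graph_on V) 2"
abbreviation "spr \<equiv> spread (graph_on V)"

definition parity :: "bool \<Rightarrow> nat set" where
  "parity e = {x \<in> V. even_depth x = e}"

lemma spread_parity: "spr (parity e) \<subseteq> parity (\<not> e)"
  by (auto simp: spread_def parity_def edges_def)

text \<open>The hunt starts from the whole class of \<open>q\<close>, the worst case, and may assume
  nothing about the rest of the tree. Odd length makes it end in the opposite class.\<close>

definition clearable :: "nat \<Rightarrow> nat \<Rightarrow> bool" where
  "clearable q t \<longleftrightarrow> odd t \<and>
     hunt2 t (parity (even_depth q)) (parity (\<not> even_depth q) - desc q)"

text \<open>The branches in \<open>I\<close> are clean and \<open>q\<close> is shot, so nothing can
  spread into a branch; \<open>q\<close> itself is in the wrong class to be contaminated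
  next.\<close>

lemma shoot_top:
  assumes "q \<in> V" "\<And>x. x \<in> V \<Longrightarrow> x \<in> desc q \<Longrightarrow> x = q \<or> (\<exists>b\<in>I. x \<in> desc (child b q))"
  shows "hunt2 1 (parity (even_depth q) - (\<Union>b\<in>I. desc (child b q))) (parity (\<not> even_depth q) - desc q)"
proof (rule hunt_step)
  show "spr (parity (even_depth q) - (\<Union>b\<in>I. desc (child b q)) - {q}) \<subseteq> parity (\<not> even_depth q) - desc q"
  proof
    fix x assume "x \<in> spr (parity (even_depth q) - (\<Union>b\<in>I. desc (child b q)) - {q})"
    then obtain y where y: "y \<in> parity (even_depth q)" "\<forall>b\<in>I. y \<notin> desc (child b q)" "y \<noteq> q"
      "(x, y) \<in> edges V" by (auto simp: spread_def)
    have x: "x \<in> parity (\<not> even_depth q)" using y spread_parity by (auto simp: spread_def)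
    have "x \<notin> desc q"
    proof
      assume "x \<in> desc q"
      moreover have "x \<noteq> q" "x \<in> V" using x by (auto simp: parity_def)
      ultimately obtain b where "b \<in> I" "x \<in> desc (child b q)" using assms(2) by blast
      then show False using edges_desc_child[OF y(4)] y by blast
    qed
    then show "x \<in> parity (\<not> even_depth q) - desc q" using x by blast
  qed
qed (use assms in auto)

lemma hunt_idle: "hunt2 1 (parity e) (parity (\<not> e))"
  using spread_parity by (intro hunt_step[of "{}"]) auto

lemma clearable_leaf:
  assumes "V \<inter> desc q = {q}"
  shows "clearable q 1"
proof -
  have "q \<in> V" using assms by blast
  then have "hunt2 1 (parity (even_depth q) - (\<Union>b\<in>{}. desc (child b q))) (parity (\<not> even_depth q) - desc q)"
    by (rule shoot_top) (use assms in blast)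
  then show ?thesis by (simp add: clearable_def)
qed

text \<open>One idle round moves the contamination into the class of \<open>child b q\<close>; the
  total length is even.\<close>

lemma clearable_child_hunt:
  assumes "clearable (child b q) t"
  shows "hunt2 (1 + t) (parity (even_depth q)) (parity (even_depth q) - desc (child b q))"
  using assms hunt_trans[OF hunt_idle[of "even_depth q"]] by (auto simp: clearable_def)

lemma clearable_extend:
  assumes "q \<in> V" "V \<inter> desc q \<subseteq> insert q (desc (child b q))" "clearable (child b q) t"
  shows "clearable q (t + 2)"
proof -
  have "hunt2 1 (parity (even_depth q) - (\<Union>b\<in>{b}. desc (child b q))) (parity (\<not> even_depth q) - desc q)"
    using assms by (intro shoot_top) auto
  then have "hunt2 1 (parity (even_depth q) - desc (child b q)) (parity (\<not> even_depth q) - desc q)"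
    by simp
  then have "hunt2 (1 + t + 1) (parity (even_depth q)) (parity (\<not> even_depth q) - desc q)"
    by (rule hunt_trans[OF clearable_child_hunt[OF assms(3)]])
  then show ?thesis using assms(3) by (simp add: clearable_def)
qed

lemma clearable_limb:
  assumes "subtrees F" "\<And>q. V \<inter> desc q = F q \<Longrightarrow> clearable q t" "V \<inter> desc q = limb m F q"
  shows "clearable q (t + 2 * m)"
  using assms(3)
proof (induction m arbitrary: q)
  case 0
  then show ?case using assms(2) by simp
next
  case (Suc m)
  have "q \<in> V" using Suc.prems by auto
  moreover have "V \<inter> desc q \<subseteq> insert q (desc (child 0 q))"
    using Suc.prems subtreesD(3)[OF subtrees_limb[OF assms(1)], of m "child 0 q"] by auto
  ultimately show ?case
    using clearable_extend Suc.IH[OF desc_Int_limb[OF assms(1) Suc.prems]] by fastforce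
qed

text \<open>The part of a limb, and of what hangs from it, that contamination entering a clean
  branch from above has not reached after \<open>s\<close> rounds.\<close>

definition beyond :: "nat \<Rightarrow> nat \<Rightarrow> nat set" where
  "beyond p s = desc (limb_vertex p s)"

lemma beyond_0 [simp]: "beyond p 0 = desc p"
  by (simp add: beyond_def)

lemma spread_beyond: "spr (- beyond p s) \<subseteq> - beyond p (Suc s)"
proof -
  have "y \<in> beyond p s" if "(x, y) \<in> edges V" "x \<in> beyond p (Suc s)" for x y
    using edges_desc_child[OF that(1)] that(2) desc_child_subset
    unfolding beyond_def limb_vertex_Suc by blast
  then show ?thesis by (auto simp: spread_def)
qed

text \<open>The price of working elsewhere for \<open>n\<close> rounds: the clean part of a limb
  recedes by \<open>n\<close> vertices.\<close>

lemma hunt_leak: "hunt2 n A B \<Longrightarrow> hunt2 n (A - beyond p s) (B - beyond p (s + n))"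
  using hunt_Int[of "graph_on V" 2 n A B "\<lambda>j. - beyond p (s + j)"] spread_beyond
  by (simp add: Diff_eq)

text \<open>Shooting at \<open>r\<close> in every round keeps a clean set of this kind
  clean.\<close>

definition guarded :: "nat \<Rightarrow> nat set \<Rightarrow> bool" where
  "guarded r C \<longleftrightarrow> (\<forall>x\<in>C. \<forall>y. (x, y) \<in> edges V \<longrightarrow> y \<in> C \<or> y = r)"

lemma guarded_desc_child: "guarded q (desc (child b q))"
  unfolding guarded_def by (blast dest: edges_desc_child)

lemma guarded_Un: "guarded r C \<Longrightarrow> guarded r D \<Longrightarrow> guarded r (C \<union> D)"
  by (auto simp: guarded_def)

text \<open>One hunter drives the contamination up the limb, while the other one shoots the root
  \<^term>\<open>r\<close> of the limb; in every other round that second shot is superfluous.\<close>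
lemma sweep:
  assumes "subtrees F" "r \<in> V" "V \<inter> desc (child b r) = limb L F (child b r)" "guarded r C" "s \<le> L"
  shows "hunt2 s (parity (even_depth r \<longleftrightarrow> even s) - beyond (child b r) s - C)
    (parity (even_depth r) - desc (child b r) - C)"
  using assms(5)
proof (induction s)
  case 0
  then show ?case by (simp add: hunt_0)
next
  case (Suc s)
  let ?p = "child b r"
  let ?v = "limb_vertex ?p s"
  have "V \<inter> beyond ?p s = limb (Suc (L - Suc s)) F ?v"
    using desc_Int_limb_vertex[OF assms(1,3), of s] Suc.prems by (simp add: beyond_def Suc_diff_Suc)
  moreover have "limb (L - Suc s) F (child 0 ?v) \<subseteq> beyond ?p (Suc s)"
    using subtreesD(3)[OF subtrees_limb[OF assms(1)]] by (simp add: beyond_def limb_vertex_Suc)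
  ultimately have v: "?v \<in> V" "V \<inter> beyond ?p s \<subseteq> insert ?v (beyond ?p (Suc s))" by auto
  \<comment> \<open>By parity \<open>?v\<close> cannot be contaminated in the coming round, so the
    clean part gains this vertex.\<close>
  have depth_v: "even_depth ?v \<longleftrightarrow> \<not> (even_depth r \<longleftrightarrow> even s)"
    by (induction s) (auto simp: limb_vertex_Suc)
  have out: "y \<in> insert ?v (beyond ?p (Suc s))" if "(x, y) \<in> edges V" "x \<in> beyond ?p (Suc s)" for x y
    using edges_desc_child[OF that(1), of 0 ?v] that(2) by (auto simp: beyond_def limb_vertex_Suc)
  have "spr (parity (even_depth r \<longleftrightarrow> even (Suc s)) - beyond ?p (Suc s) - C - {?v, r})
    \<subseteq> parity (even_depth r \<longleftrightarrow> even s) - beyond ?p s - C"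
  proof
    fix x assume "x \<in> spr (parity (even_depth r \<longleftrightarrow> even (Suc s)) - beyond ?p (Suc s) - C - {?v, r})"
    then obtain y where y: "y \<in> parity (even_depth r \<longleftrightarrow> even (Suc s))" "y \<notin> beyond ?p (Suc s)"
      "y \<notin> C" "y \<noteq> ?v" "y \<noteq> r" "(x, y) \<in> edges V" by (auto simp: spread_def)
    have "x \<in> spr (parity (even_depth r \<longleftrightarrow> even (Suc s)))" using y by (auto simp: spread_def)
    then have x: "x \<in> parity (even_depth r \<longleftrightarrow> even s)" using spread_parity by fastforce
    have "x \<notin> C" using y assms(4) by (auto simp: guarded_def)
    moreover have "x \<notin> beyond ?p s"
      using v(2) x depth_v out[OF y(6)] y by (auto simp: parity_def)
    ultimately show "x \<in> parity (even_depth r \<longleftrightarrow> even s) - beyond ?p s - C" using x by blast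
  qed
  moreover have "card {?v, r} \<le> 2" by (simp add: card_insert_if)
  ultimately show ?case
    using Suc v(1) assms(2)
    by (intro hunt_Suc[of "{?v, r}"]) (auto intro: hunt_mono)
qed

text \<open>Clear branch 0; clear branch 1 and sweep limb 0; clear branch 2, sweep limb 0, then limb
  1; finally shoot \<open>q\<close>. Limb 0 leaks for \<open>1 + t 1\<close> and later for
  \<open>1 + t 2\<close> rounds, limb 1 for \<open>2 * (1 + t 2)\<close> rounds, and the bounds on
  \<open>L\<close> keep these leaks inside the limbs.\<close>

lemma clearable_join:
  assumes F: "subtrees F" and V: "V \<inter> desc q = join (\<lambda>b. limb (L b) F) q"
    and cl: "\<And>b. b < 3 \<Longrightarrow> clearable (child b q) (t b)"
    and L: "1 + t 1 \<le> L 0" "1 + t 2 \<le> L 0" "2 * (1 + t 2) \<le> L 1"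
  shows "clearable q (1 + t 0 + 2 * (1 + t 1) + 4 * (1 + t 2) + 1)"
proof -
  let ?K = "parity (even_depth q)"
  let ?D = "\<lambda>b. desc (child b q)"
  let ?s1 = "1 + t 1" and ?s2 = "1 + t 2"
  have q: "q \<in> V" using V by (auto simp: join_def)
  have V': "V \<inter> desc (child b q) = limb (L b) F (child b q)" if "b < 3" for b
    using desc_Int_join[OF _ V that] subtrees_limb[OF F] by simp
  \<comment> \<open>Hence every stage before the last begins and ends in the class of
    \<open>q\<close>.\<close>
  have even: "even ?s1" "even ?s2" using cl by (auto simp: clearable_def)
  note fill = clearable_child_hunt[OF cl]
  have sw: "hunt2 s (?K - beyond (child b q) s - C) (?K - ?D b - C)"
    if "b < 3" "guarded q C" "s \<le> L b" "even s" for b C s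
    using sweep[OF F q V'[OF that(1)] that(2,3)] that(4) by simp
  have 1: "hunt2 (1 + t 0) ?K (?K - ?D 0)" using fill[of 0] by simp
  have 2: "hunt2 ?s1 (?K - ?D 0) (?K - beyond (child 0 q) ?s1 - ?D 1)"
    using hunt_leak[OF fill[of 1], of "child 0 q" 0] by (auto intro: hunt_mono)
  have 3: "hunt2 ?s1 (?K - beyond (child 0 q) ?s1 - ?D 1) (?K - ?D 0 - ?D 1)"
    using sw[OF _ guarded_desc_child] L even by simp
  have "hunt2 ?s2 (?K - ?D 0) (?K - ?D 2 - beyond (child 0 q) ?s2)"
    using hunt_leak[OF fill[of 2], of "child 0 q" 0] by simp
  from hunt_leak[OF this, of "child 1 q" 0]
  have 4: "hunt2 ?s2 (?K - ?D 0 - ?D 1)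
    (?K - beyond (child 0 q) ?s2 - ?D 2 - beyond (child 1 q) ?s2)"
    by (auto intro: hunt_mono)
  have "hunt2 ?s2 (?K - beyond (child 0 q) ?s2 - ?D 2) (?K - ?D 0 - ?D 2)"
    using sw[OF _ guarded_desc_child] L even by simp
  \<comment> \<open>While limb 0 is swept, limb 1 goes on leaking, which doubles the depth of its
    leak.\<close>
  from hunt_leak[OF this, of "child 1 q" ?s2]
  have 5: "hunt2 ?s2 (?K - beyond (child 0 q) ?s2 - ?D 2 - beyond (child 1 q) ?s2)
    (?K - beyond (child 1 q) (2 * ?s2) - (?D 0 \<union> ?D 2))"
    by (auto intro: hunt_mono simp: mult_2)
  have 6: "hunt2 (2 * ?s2) (?K - beyond (child 1 q) (2 * ?s2) - (?D 0 \<union> ?D 2))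
    (?K - ?D 1 - (?D 0 \<union> ?D 2))"
    using L even by (intro sw guarded_Un guarded_desc_child) auto
  have "hunt2 1 (?K - (\<Union>b<3. ?D b)) (parity (\<not> even_depth q) - desc q)"
  proof (rule shoot_top[OF q])
    fix x assume "x \<in> V" "x \<in> desc q"
    then have "x \<in> join (\<lambda>b. limb (L b) F) q" using V by blast
    then show "x = q \<or> (\<exists>b\<in>{..<3}. x \<in> desc (child b q))"
      using subtreesD(3)[OF subtrees_limb[OF F]] by (fastforce simp: join_def)
  qed
  moreover have "?K - ?D 1 - (?D 0 \<union> ?D 2) = ?K - (\<Union>b<3. ?D b)"
    by (auto simp: eval_nat_numeral less_Suc_eq)
  ultimately have 7: "hunt2 1 (?K - ?D 1 - (?D 0 \<union> ?D 2)) (parity (\<not> even_depth q) - desc q)"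
    by simp
  have "hunt2 (1 + t 0 + ?s1 + ?s1 + ?s2 + ?s2 + 2 * ?s2 + 1) ?K (parity (\<not> even_depth q) - desc q)"
    by (rule hunt_trans[OF hunt_trans[OF hunt_trans[OF hunt_trans[OF hunt_trans[OF
      hunt_trans[OF 1 2] 3] 4] 5] 6] 7])
  moreover have "1 + t 0 + ?s1 + ?s1 + ?s2 + ?s2 + 2 * ?s2 + 1 = 1 + t 0 + 2 * ?s1 + 4 * ?s2 + 1"
    by simp
  ultimately have "hunt2 (1 + t 0 + 2 * ?s1 + 4 * ?s2 + 1) ?K (parity (\<not> even_depth q) - desc q)"
    by (simp only:)
  then show ?thesis using cl[of 0] by (simp add: clearable_def)
qed

end

section \<open>The trees\<close>

text \<open>If a copy of the previous tree is cleared in \<^term>\<open>t\<close> rounds, these lengths satisfy the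
  hypotheses of \<open>clearable_join\<close>, and the recursion for \<open>clear_time\<close> below is its conclusion.\<close>
definition limb_length :: "nat \<Rightarrow> nat \<Rightarrow> nat" where
  "limb_length t b = (if b = 0 then 5 * t + 29 else if b = 1 then 2 * t + 14 else 3)"

primrec clear_time :: "nat \<Rightarrow> nat \<Rightarrow> nat" where
  "clear_time m 0 = 2 * m + 1"
| "clear_time m (Suc n) = 25 * clear_time m n + 146"

text \<open>The recursion starts from a path with \<open>m\<close> edges instead of a single vertex:
  a path that is not cleared in one round supplies the first boundary vertex.\<close>

primrec hard_tree :: "nat \<Rightarrow> nat \<Rightarrow> nat \<Rightarrow> nat set" where
  "hard_tree m 0 = limb m (\<lambda>q. {q})"
| "hard_tree m (Suc n) = join (\<lambda>b. limb (limb_length (clear_time m n) b) (hard_tree m n))"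

lemma subtrees_hard_tree: "subtrees (hard_tree m n)"
  by (induction n) (simp_all add: subtrees_limb subtrees_singleton subtrees_join)

lemma (in rooted) clearable_hard_tree:
  "V \<inter> desc q = hard_tree m n q \<Longrightarrow> clearable q (clear_time m n)"
proof (induction n arbitrary: q)
  case 0
  then have "clearable q (1 + 2 * m)"
    using clearable_limb[OF subtrees_singleton clearable_leaf] by simp
  then show ?case by simp
next
  case (Suc n)
  let ?t = "clear_time m n"
  let ?T = "hard_tree m n"
  let ?L = "limb_length ?t"
  have V: "V \<inter> desc q = join (\<lambda>b. limb (?L b) ?T) q" using Suc.prems by simp
  have "clearable (child b q) (?t + 2 * ?L b)" if "b < 3" for b
    using clearable_limb[OF subtrees_hard_tree[of m n] Suc.IH, of "child b q" "?L b"]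
      desc_Int_join[OF _ V that] subtrees_limb[OF subtrees_hard_tree] by simp
  then have "clearable q (1 + (?t + 2 * ?L 0) + 2 * (1 + (?t + 2 * ?L 1)) + 4 * (1 + (?t + 2 * ?L 2)) + 1)"
    by (rule clearable_join[OF subtrees_hard_tree V]) (auto simp: limb_length_def)
  then show ?case by (simp add: limb_length_def add.commute)
qed

lemma rooted_hard_tree: "rooted (hard_tree m n 0)"
  using subtreesD[OF subtrees_hard_tree] by unfold_locales (blast, blast, metis child_neq(3))

section \<open>Vertex separation\<close>

text \<open>For injective \<open>c\<close> these sets define the vertex separation of the order. As
  clearing times may tie, constant \<open>c\<close> has to be excluded separately.\<close>

definition boundary :: "(nat \<Rightarrow> nat) \<Rightarrow> nat set \<Rightarrow> nat \<Rightarrow> nat set" where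
  "boundary c F t = {u \<in> F. c u \<le> t \<and> (\<exists>v\<in>F. (u, v) \<in> edges F \<and> t < c v)}"

lemma boundary_mono: "F \<subseteq> F' \<Longrightarrow> boundary c F t \<subseteq> boundary c F' t"
  by (auto simp: boundary_def edges_def)

lemma boundary_subset: "boundary c F t \<subseteq> F"
  by (auto simp: boundary_def)

lemma finite_boundary: "subtrees F \<Longrightarrow> finite (boundary c (F q) t)"
  by (rule finite_subset[OF boundary_subset]) (rule subtreesD(1))

lemma ex_crossing_edge:
  assumes "y \<in> desc q" "\<And>b x. child b x \<in> X \<Longrightarrow> child b x \<noteq> q \<Longrightarrow> x \<in> X" "y \<in> X" "P q" "\<not> P y"
  shows "\<exists>b x. x \<in> X \<and> child b x \<in> X \<and> P x \<and> \<not> P (child b x)"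
  using assms(1,3,5)
proof (induction rule: desc.induct)
  case desc_refl
  then show ?case using assms(4) by blast
next
  case (desc_child x b)
  then have "x \<in> X" using assms(2,4) by blast
  then show ?case using desc_child by blast
qed

lemma boundary_nonempty:
  assumes "X \<subseteq> desc q" "q \<in> X" "\<And>b x. child b x \<in> X \<Longrightarrow> child b x \<noteq> q \<Longrightarrow> x \<in> X"
    and "x \<in> X" "c x \<le> t" "y \<in> X" "t < c y"
  shows "boundary c X t \<noteq> {}"
proof (cases "c q \<le> t")
  case True
  obtain b z where "z \<in> X" "child b z \<in> X" "c z \<le> t" "\<not> c (child b z) \<le> t"
    using ex_crossing_edge[of y q X "\<lambda>x. c x \<le> t"] assms True by (auto simp: not_le)
  then have "z \<in> boundary c X t" by (auto simp: boundary_def edges_def intro: bexI[of _ "child b z"])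
  then show ?thesis by blast
next
  case False
  obtain b z where "z \<in> X" "child b z \<in> X" "\<not> c z \<le> t" "c (child b z) \<le> t"
    using ex_crossing_edge[of x q X "\<lambda>x. \<not> c x \<le> t"] assms False by auto
  then have "child b z \<in> boundary c X t" by (auto simp: boundary_def edges_def intro: bexI[of _ z])
  then show ?thesis by blast
qed

lemma ex_sorted_three:
  fixes t :: "nat \<Rightarrow> nat"
  obtains a b d where "a < 3" "b < 3" "d < 3" "a \<noteq> b" "b \<noteq> d" "a \<noteq> d" "t a \<le> t b" "t b \<le> t d"
proof -
  consider "t 0 \<le> t 1" "t 1 \<le> t 2" | "t 0 \<le> t 2" "t 2 \<le> t 1" | "t 1 \<le> t 0" "t 0 \<le> t 2"
    | "t 1 \<le> t 2" "t 2 \<le> t 0" | "t 2 \<le> t 0" "t 0 \<le> t 1" | "t 2 \<le> t 1" "t 1 \<le> t 0"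
    by linarith
  then show ?thesis by cases (rule that; simp; fail)+
qed

text \<open>At the middle one of the three times at which the branches have large boundaries, one of
  the other branches is partly cleared and the third one is not yet completely cleared, so the
  path between them contributes a boundary vertex outside the middle branch.\<close>
lemma boundary_join:
  assumes F: "\<And>b. b < 3 \<Longrightarrow> subtrees (F b)"
    and k: "\<And>b. b < 3 \<Longrightarrow> \<exists>t. k \<le> card (boundary c (F b (child b q)) t)" "0 < k"
  shows "\<exists>t. Suc k \<le> card (boundary c (join F q) t)"
proof -
  let ?B = "\<lambda>b. F b (child b q)"
  obtain t where t: "k \<le> card (boundary c (?B b) (t b))" if "b < 3" for b
    using k(1) by metis
  obtain a b d where abd: "a < 3" "b < 3" "d < 3" "a \<noteq> b" "b \<noteq> d" "a \<noteq> d" "t a \<le> t b" "t b \<le> t d"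
    by (rule ex_sorted_three)
  note D = subtreesD[OF F]
  have ne: "boundary c (?B b) (t b) \<noteq> {}" if "b < 3" for b
    using t[OF that] k(2) by auto
  obtain x where x: "x \<in> ?B a" "c x \<le> t b"
    using ne[OF abd(1)] abd(7) by (auto simp: boundary_def)
  obtain y where y: "y \<in> ?B d" "t b < c y"
    using ne[OF abd(3)] abd(8) by (auto simp: boundary_def)
  \<comment> \<open>A connected set avoiding branch \<open>b\<close>, so that its boundary vertex is
    a new one.\<close>
  define X where "X = insert q (?B a \<union> ?B d)"
  have sub: "?B b \<subseteq> desc (child b q)" if "b < 3" for b using D(3)[OF that] .
  have "boundary c X (t b) \<noteq> {}"
  proof (rule boundary_nonempty[of X q])
    show "X \<subseteq> desc q"
      using sub[OF abd(1)] sub[OF abd(3)] desc_child_subset unfolding X_def by blast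
    fix e z assume z: "child e z \<in> X" "child e z \<noteq> q"
    then consider "child e z \<in> ?B a" | "child e z \<in> ?B d" by (auto simp: X_def)
    then show "z \<in> X"
    proof cases
      case 1
      then show ?thesis using D(4)[OF abd(1) 1] by (auto simp: X_def)
    next
      case 2
      then show ?thesis using D(4)[OF abd(3) 2] by (auto simp: X_def)
    qed
  qed (use x y in \<open>auto simp: X_def\<close>)
  then obtain u where u: "u \<in> boundary c X (t b)" by blast
  then have "u \<in> X" using boundary_subset by blast
  moreover have "q \<notin> ?B b" using sub[OF abd(2)] not_in_desc_child by blast
  moreover have "?B a \<inter> ?B b = {}" "?B d \<inter> ?B b = {}"
    using sub[OF abd(1)] sub[OF abd(2)] sub[OF abd(3)] abd(4,5) desc_child_disjoint by blast+
  ultimately have u': "u \<notin> boundary c (?B b) (t b)"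
    using boundary_subset unfolding X_def by blast
  have "X \<subseteq> join F q" "?B b \<subseteq> join F q" using abd by (auto simp: X_def join_def)
  then have "insert u (boundary c (?B b) (t b)) \<subseteq> boundary c (join F q) (t b)"
    using u boundary_mono by blast
  moreover have "finite (boundary c (join F q) (t b))"
    using F by (intro finite_boundary subtrees_join)
  ultimately have "card (insert u (boundary c (?B b) (t b))) \<le> card (boundary c (join F q) (t b))"
    by (intro card_mono)
  moreover have "finite (boundary c (?B b) (t b))"
    by (rule finite_boundary[OF F[OF abd(2)]])
  ultimately have "Suc k \<le> card (boundary c (join F q) (t b))"
    using u' t[OF abd(2)] by simp
  then show ?thesis by blast
qed

lemma boundary_limb:
  assumes "subtrees F" "k \<le> card (boundary c (F (limb_vertex q m)) t)"
  shows "k \<le> card (boundary c (limb m F q) t)"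
proof -
  have "boundary c (F (limb_vertex q m)) t \<subseteq> boundary c (limb m F q) t"
    by (rule boundary_mono) (simp add: limb_conv)
  moreover have "finite (boundary c (limb m F q) t)"
    using assms(1) by (intro finite_boundary subtrees_limb)
  ultimately show ?thesis using assms(2) card_mono le_trans by blast
qed

text \<open>The base path gives one boundary vertex and each join adds one; \<open>nonconst\<close>
  is confined to paths in \<open>V\<close>, the only place where clearing times are
  controlled.\<close>

lemma boundary_hard_tree:
  assumes nonconst: "\<And>q. limb m (\<lambda>q. {q}) q \<subseteq> V \<Longrightarrow> \<exists>x\<in>limb m (\<lambda>q. {q}) q. \<exists>y\<in>limb m (\<lambda>q. {q}) q. c x < c y"
  shows "hard_tree m n q \<subseteq> V \<Longrightarrow> \<exists>t. Suc n \<le> card (boundary c (hard_tree m n q) t)"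
proof (induction n arbitrary: q)
  case 0
  let ?P = "limb m (\<lambda>q. {q}) q"
  note D = subtreesD[OF subtrees_limb[OF subtrees_singleton]]
  obtain x y where "x \<in> ?P" "y \<in> ?P" "c x < c y" using nonconst[of q] 0 by auto
  then have "boundary c ?P (c x) \<noteq> {}"
    by (intro boundary_nonempty[OF D(3) D(2) D(4)]) auto
  moreover have "finite (boundary c ?P (c x))"
    by (intro finite_boundary subtrees_limb subtrees_singleton)
  ultimately show ?case by (auto simp: Suc_le_eq card_gt_0_iff)
next
  case (Suc n)
  let ?L = "limb_length (clear_time m n)"
  have "\<exists>t. Suc n \<le> card (boundary c (limb (?L b) (hard_tree m n) (child b q)) t)" if b: "b < 3" for b
  proof -
    have "hard_tree m n (limb_vertex (child b q) (?L b)) \<subseteq> V"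
      using Suc.prems b by (auto simp: join_def limb_conv)
    then show ?thesis using Suc.IH boundary_limb[OF subtrees_hard_tree] by blast
  qed
  then show ?case
    using boundary_join[of "\<lambda>b. limb (?L b) (hard_tree m n)" "Suc n" c q]
      subtrees_limb[OF subtrees_hard_tree] by simp
qed

lemma even_depth_limb_vertex: "even_depth (limb_vertex q s) \<longleftrightarrow> (even_depth q \<longleftrightarrow> even s)"
  by (induction s) (auto simp: limb_vertex_Suc)

lemma inj_limb_vertex: "inj (limb_vertex q)"
  by (rule strict_mono_imp_inj_on) (simp add: strict_mono_Suc_iff limb_vertex_Suc)

lemma card_limb_parity:
  assumes "finite (limb (2 * k) F q)"
  shows "k \<le> card {x \<in> limb (2 * k) F q. even_depth x = e}"
proof -
  \<comment> \<open>Depth alternates along the limb; the offset \<open>?r\<close> selects the class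
    \<open>e\<close>, and the indices stay below \<open>2 * k\<close>.\<close>
  let ?r = "if even_depth q = e then 0 else 1 :: nat"
  let ?f = "\<lambda>j. limb_vertex q (2 * j + ?r)"
  have "inj_on ?f {..<k}"
    by (intro inj_onI) (simp add: inj_eq[OF inj_limb_vertex])
  then have "k = card (?f ` {..<k})" by (simp add: card_image)
  also have "\<dots> \<le> card {x \<in> limb (2 * k) F q. even_depth x = e}"
    using assms by (intro card_mono) (auto simp: limb_conv even_depth_limb_vertex)
  finally show ?thesis .
qed

section \<open>The gap\<close>

theorem theorem5p2:
  fixes i :: nat
  assumes "3 \<le> i"
  shows "\<exists>(T :: nat pair_pre_digraph) Vr Vw.
           undirected_tree T \<and> bipartition T Vr Vw \<and>
           i \<le> monotone_hunter_number_from T Vr \<and>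
           hunter_number_from T Vr = 2 \<and> hunter_number T = 2"
proof -
  \<comment> \<open>A base path with \<open>2 * i\<close> edges has at least \<open>i\<close>
    vertices in each class, too many for fewer than \<open>i\<close> hunters to clear it all at
    once. With \<open>3 * i + 1\<close> joins the boundary reaches \<open>3 * i + 2\<close>, more
    than \<open>3 * num_hunters S\<close>.\<close>
  define F where "F = (\<lambda>b. limb (limb_length (clear_time (2 * i) (3 * i)) b) (hard_tree (2 * i) (3 * i)))"
  define V where "V = hard_tree (2 * i) (Suc (3 * i)) 0"
  let ?G = "graph_on V"
  interpret rooted V unfolding V_def by (rule rooted_hard_tree)
  have V_join: "V = join F 0" by (simp add: V_def F_def)
  have legs: "limb_vertex (child b 0) s \<in> V" if "b < 3" "s < 3" for b s
    using that unfolding V_join F_def limb_conv join_def by (fastforce simp: limb_length_def)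
  have bip: "bipartition ?G (parity True) (parity False)"
    using bipartition_graph_on by (simp add: parity_def)
  have Vr_subset: "parity True \<subseteq> V" by (auto simp: parity_def)
  have V_parity: "V = parity True \<union> parity False" by (auto simp: parity_def)

  \<comment> \<open>Stated for all \<open>W\<close> containing the class of the root, this serves
    both hunter numbers. The spider consists of the root and the first three vertices of each
    branch.\<close>
  have lower: "2 \<le> num_hunters S"
    if S: "hunter_strategy ?G S" "winning ?G W S" and W: "parity True \<subseteq> W" for S W
  proof (rule ccontr)
    assume less: "\<not> 2 \<le> num_hunters S"
    have "finite X \<and> card X \<le> 1" if "X \<in> set S" for X
    proof
      have "X \<subseteq> V" using that S(1) by (simp add: hunter_strategy_def)
      then show "finite X" by (rule finite_subset) simp
      show "card X \<le> 1" using card_le_num_hunters[OF that] less by linarith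
    qed
    moreover have "(0, child b 0) \<in> edges V \<and> (child b 0, child 0 (child b 0)) \<in> edges V \<and>
      (child 0 (child b 0), child 0 (child 0 (child b 0))) \<in> edges V" if "b < 3" for b
      using legs[OF that, of 0] legs[OF that, of 1] legs[OF that, of 2]
      by (auto simp: edges_def limb_vertex_def numeral_2_eq_2)
    moreover have "child 0 (child b 0) \<in> W" if "b < 3" for b
      using legs[OF that, of 1] W by (auto simp: parity_def limb_vertex_def)
    moreover have "0 \<in> W" using W by (auto simp: parity_def)
    moreover have "child b 0 \<noteq> child 0 (child 0 (child b 0))" for b
      using less_child[of "child b 0" 0] less_child[of "child 0 (child b 0)" 0] by linarith
    ultimately show False
      using S(2) one_hunter_loses_spider[of ?G 0 "\<lambda>b. child b 0" "\<lambda>b. child 0 (child b 0)"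
        "\<lambda>b. child 0 (child 0 (child b 0))" W S] sym_edges
      by (simp add: inj_on_def)
  qed

  define t where "t = clear_time (2 * i) (Suc (3 * i))"
  have all: "V \<inter> desc 0 = V" using desc_0 by blast
  then have "clearable 0 t" unfolding t_def by (intro clearable_hard_tree) (simp add: V_def)
  then have "odd t" "hunt2 t (parity True) {}"
    using desc_0 by (auto simp: clearable_def elim: hunt_mono)
  then obtain S where S: "length S = t" "\<forall>X\<in>set S. X \<noteq> {} \<and> X \<subseteq> V \<and> card X \<le> 2"
    "contaminated ?G (parity True) S t = {}"
    using hunt_imp_strategy[of ?G 2 t "parity True" "{}"] by auto
  have "S \<noteq> []" using S(1) \<open>odd t\<close> by auto
  then have strategies: "hunter_strategy ?G S" "hunter_strategy ?G (S @ S)"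
    using S(2) by (auto simp: hunter_strategy_def)
  then have few: "num_hunters S \<le> 2" "num_hunters (S @ S) \<le> 2"
    using S(2) by (auto intro: num_hunters_le)
  have win: "winning ?G (parity True) S"
    using S by (simp add: winning_iff_contaminated_empty sym_edges)
  \<comment> \<open>Against a rabbit with arbitrary start \<open>S\<close> is played twice: after
    the odd number \<open>t\<close> of rounds, one that started in the other class is in
    \<open>parity True\<close>, where the second pass catches it.\<close>
  have "contaminated ?G (parity False) S n \<subseteq> parity (odd n)" for n
  proof (induction n)
    case (Suc n)
    then have "contaminated ?G (parity False) S (Suc n) \<subseteq> spr (parity (odd n))"
      unfolding contaminated_Suc by (intro spread_mono) auto
    then show ?case using spread_parity[of "odd n"] by simp
  qed simp
  from this[of t] have "contaminated ?G (parity False) S t \<subseteq> parity True"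
    using \<open>odd t\<close> by simp
  then have "contaminated ?G V S t \<subseteq> parity True"
    unfolding contaminated_Un[of ?G "parity True" "parity False" S t, folded V_parity] S(3) by simp
  then have "contaminated ?G (contaminated ?G V S t) S t = {}"
    using contaminated_mono S(3) by (metis subset_empty)
  then have "contaminated ?G V (S @ S) (t + t) = {}"
    using contaminated_append[of ?G V S S t] S(1) by simp
  then have win2: "winning ?G V (S @ S)"
    using S(1) by (simp add: winning_iff_contaminated_empty sym_edges)

  have "i \<le> num_hunters S"
    if S: "hunter_strategy ?G S" "monotone_strategy ?G (parity True) S" "winning ?G (parity True) S" for S
  proof (rule ccontr)
    assume less: "\<not> i \<le> num_hunters S"
    have "nbrs ?G v \<noteq> {}" if "v \<in> V" for v
    proof (cases "v = 0")
      case True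
      then have "child 0 0 \<in> nbrs ?G v"
        using legs[of 0 0] by (auto simp: nbrs_def edges_def)
      then show ?thesis by blast
    next
      case False
      then obtain b where "v = child b (par v)" using ex_child by blast
      then have "par v \<in> nbrs ?G v"
        using that child_inD[of b "par v"] by (auto simp: nbrs_def edges_def)
      then show ?thesis by blast
    qed
    then interpret monotone_hunt ?G "parity True" "parity False" S
      using S bip sym_edges by unfold_locales (auto simp: edges_def)
    \<comment> \<open>If all of \<open>P\<close> had the same clearing time, one of its two classes,
      each with at least \<open>i\<close> vertices, would have at most
      \<open>num_hunters S\<close>.\<close>
    have nonconst: "\<exists>x\<in>P. \<exists>y\<in>P. ctime x < ctime y"
      if P: "P = limb (2 * i) (\<lambda>q. {q}) q" "P \<subseteq> V" for P q
    proof (rule ccontr)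
      assume "\<not> ?thesis"
      moreover have "q \<in> P"
        using P(1) subtreesD(2)[OF subtrees_limb[OF subtrees_singleton]] by simp
      ultimately have "\<And>v. v \<in> P \<Longrightarrow> ctime v = ctime q" by (meson linorder_neqE_nat)
      then have "card (P \<inter> parity True) \<le> num_hunters S \<or> card (P \<inter> parity False) \<le> num_hunters S"
        using P(2) by (intro simultaneously_cleared) auto
      moreover have "P \<inter> parity e = {x \<in> limb (2 * i) (\<lambda>q. {q}) q. even_depth x = e}" for e
        using P by (auto simp: parity_def)
      then have "i \<le> card (P \<inter> parity e)" for e
        using card_limb_parity P subtreesD(1)[OF subtrees_limb[OF subtrees_singleton]] by simp
      ultimately show False using less le_trans by blast
    qed
    obtain s where s: "Suc (Suc (3 * i)) \<le> card (boundary ctime V s)"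
      using boundary_hard_tree[of "2 * i" V ctime "Suc (3 * i)" 0] nonconst unfolding V_def by blast
    also have "\<dots> \<le> 3 * num_hunters S"
      using card_boundary[of V s] by (simp add: boundary_def)
    finally show False using less by simp
  qed
  then have "i \<le> monotone_hunter_number_from ?G (parity True)"
    using Vr_subset by (intro monotone_hunter_number_from_ge) auto
  moreover have "hunter_number_from ?G (parity True) = 2"
    using strategies few win lower by (intro hunter_number_from_eqI[of _ S]) auto
  moreover have "hunter_number ?G = 2"
    unfolding hunter_number_def
    using strategies few win2 lower Vr_subset by (intro hunter_number_from_eqI[of _ "S @ S"]) auto
  ultimately show ?thesis using undirected_tree_graph_on bip by blast
qed

end
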